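(* Let $u\in BMO(\mathbb{R}^N)$. Define for $\sigma\in[0,\infty)$ $$S_\sigma:=\{x\in \mathbb{R}^N : |u(x)|>\sigma\}.$$ Then $$\mathcal{L}^N(S_\sigma)\le \gamma\, e^{-\alpha\frac{\sigma-\eta}{\|u\|_{BMO(\mathbb{R}^N)}}}\,\mathcal{L}^N(S_\eta)\qquad\text{for all } 0\le\eta\le\sigma .$$ Here $\gamma=\gamma(N)$ and $\alpha=\alpha(N)$ are positive constants depending only on the dimension $N$.
   Context: $N$ is a natural number and $\mathcal{L}^N$ is Lebesgue measure on $\mathbb{R}^N$. A cube is a Cartesian product $\prod_{i=1}^N J_i$ of non-empty closed bounded intervals of the same length. For real-valued $u\in L^1_{\mathrm{loc}}(\mathbb{R}^N)$, $u\in BMO(\mathbb{R}^N)$ means that $$\|u\|_{BMO(\mathbb{R}^N)}:=\sup\left\{\frac{1}{\mathcal{L}^N(C)^2}\int_C\int_C|u(z)-u(x)|\,dz\,dx : C\subset \mathbb{R}^N\text{ a cube}\right\}<\infty .$$ *)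

theory Defs
  imports "HOL-Analysis.Analysis"
begin

definition is_cube :: "(real ^ 'n) set \<Rightarrow> bool" where
  "is_cube C \<longleftrightarrow>
    (\<exists>a l. 0 \<le> l \<and> C = {x. \<forall>i. x $ i \<in> {a $ i .. a $ i + l}})"

definition locally_L1 :: "(real ^ 'n \<Rightarrow> real) \<Rightarrow> bool" where
  "locally_L1 u \<longleftrightarrow> (\<forall>K. compact K \<longrightarrow> set_integrable lebesgue K u)"

text \<open>
  The seminorm takes values in \<^typ>\<open>ennreal\<close>, so that the supremum exists for every \<open>u\<close>.
  Cubes of side length 0 are excluded because the mean over such a cube is 0/0.
\<close>

definition bmo_norm :: "(real ^ 'n \<Rightarrow> real) \<Rightarrow> ennreal" where
  "bmo_norm u =
    (SUP C \<in> {C. is_cube C \<and> 0 < emeasure lebesgue C}.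
      (\<integral>\<^sup>+x\<in>C. (\<integral>\<^sup>+z\<in>C. ennreal \<bar>u z - u x\<bar> \<partial>lebesgue) \<partial>lebesgue) / (emeasure lebesgue C)\<^sup>2)"

definition BMO :: "(real ^ 'n \<Rightarrow> real) set" where
  "BMO = {u. locally_L1 u \<and> bmo_norm u < \<infinity>}"

definition superlevel :: "(real ^ 'n \<Rightarrow> real) \<Rightarrow> real \<Rightarrow> (real ^ 'n) set" where
  "superlevel u \<sigma> = {x. \<bar>u x\<bar> > \<sigma>}"

end

theory Submission
  imports Defs
begin

text \<open>
  Write \<open>E\<close> for the set where \<open>\<bar>u\<bar> > s\<close> and \<open>G\<close> for the set where \<open>\<bar>u\<bar> > s + t\<close>. If \<open>E\<close> has
  finite measure, the maximal dyadic cubes \<open>Q\<close> more than half filled by \<open>E\<close> are disjoint and cover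
  almost all of \<open>E\<close>. The parent \<open>P\<close> of such a \<open>Q\<close> is at most half filled by \<open>E\<close>, and
  \<open>u\<close> varies by at least \<open>t\<close> between \<open>P - E\<close> and \<open>P \<inter> G\<close>, so that
  \<open>t |P| |P \<inter> G| / 2 \<le> \<parallel>u\<parallel> |P|\<^sup>2\<close>. As \<open>|P| = 2\<^sup>N |Q| \<le> 2\<^sup>N\<^sup>+\<^sup>1 |Q \<inter> E|\<close>, summation over \<open>Q\<close> yields
  \<open>|G| \<le> 2\<^sup>N\<^sup>+\<^sup>2 \<parallel>u\<parallel> / t |E|\<close>. Hence each increase of the level by \<open>2\<^sup>N\<^sup>+\<^sup>3 \<parallel>u\<parallel>\<close> halves the
  measure of the superlevel set.
\<close>

section \<open>Dyadic cells: nesting, volume, countability and shrinking to a point\<close>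

text \<open>For \<open>L > 0\<close> this is the half-open dyadic cube of side
  \<open>L / 2 ^ n\<close> through \<open>x\<close>. Indexing by a point makes the cells of one
  generation equivalence classes, so that two of them coincide or are disjoint. The scale
  \<open>L\<close> stays free so that generation 0 can be adapted to the set under study.\<close>

definition dyadic_cell :: "real \<Rightarrow> nat \<Rightarrow> real ^ 'n \<Rightarrow> (real ^ 'n) set" where
  "dyadic_cell L n x = {y. \<forall>i. \<lfloor>2 ^ n * y $ i / L\<rfloor> = \<lfloor>2 ^ n * x $ i / L\<rfloor>}"

lemma mem_dyadic_cell_self: "x \<in> dyadic_cell L n x"
  by (simp add: dyadic_cell_def)

lemma dyadic_cell_eq: "y \<in> dyadic_cell L n x \<Longrightarrow> dyadic_cell L n y = dyadic_cell L n x"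
  by (simp add: dyadic_cell_def)

text \<open>The index of a coordinate in generation \<open>m\<close> is the integer quotient of its
  index in generation \<open>n\<close> by \<open>2 ^ (n - m)\<close>, so the finer index determines
  the coarser one.\<close>

lemma dyadic_cell_antimono:
  assumes "m \<le> n" shows "dyadic_cell L n x \<subseteq> dyadic_cell L m x"
proof -
  have "\<lfloor>2 ^ m * r / L\<rfloor> = \<lfloor>2 ^ n * r / L\<rfloor> div 2 ^ (n - m)" for r :: real
  proof -
    have "(2::real) ^ n = 2 ^ m * 2 ^ (n - m)"
      using assms by (simp flip: power_add)
    then have "2 ^ m * r / L = (2 ^ n * r / L) / real_of_int (2 ^ (n - m))"
      by simp
    then show ?thesis
      using floor_divide_real_eq_div[of "2 ^ (n - m)" "2 ^ n * r / L"] by simp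
  qed
  then show ?thesis
    by (auto simp: dyadic_cell_def)
qed

lemma dyadic_cell_bounds:
  fixes x :: "real ^ 'n"
  assumes "L > 0"
  obtains a where
    "dyadic_cell L n x = {y. \<forall>i. a $ i \<le> y $ i \<and> y $ i < a $ i + L / 2 ^ n}"
proof
  let ?a = "\<chi> i. L / 2 ^ n * real_of_int \<lfloor>2 ^ n * x $ i / L\<rfloor>"
  have "\<lfloor>2 ^ n * r / L\<rfloor> = k \<longleftrightarrow> L / 2 ^ n * k \<le> r \<and> r < L / 2 ^ n * k + L / 2 ^ n" for r k
    using assms by (simp add: floor_eq_iff field_simps)
  then show "dyadic_cell L n x = {y. \<forall>i. ?a $ i \<le> y $ i \<and> y $ i < ?a $ i + L / 2 ^ n}"
    by (simp add: dyadic_cell_def)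
qed

lemma emeasure_equilateral_box:
  fixes a :: "real ^ 'n"
  assumes "l \<ge> 0"
  shows "emeasure lebesgue (cbox a (\<chi> i. a $ i + l)) = ennreal (l ^ CARD('n))"
    and "emeasure lebesgue (box a (\<chi> i. a $ i + l)) = ennreal (l ^ CARD('n))"
proof -
  have b: "((\<chi> i. a $ i + l) - a) \<bullet> b = l" if "b \<in> Basis" for b
    using that by (auto simp: Basis_vec_def inner_axis)
  then have "(\<Prod>b\<in>Basis. ((\<chi> i. a $ i + l) - a) \<bullet> b) = l ^ CARD('n)"
    by simp
  moreover have "\<forall>b\<in>Basis. a \<bullet> b \<le> (\<chi> i. a $ i + l) \<bullet> b"
    using b assms by (metis inner_diff_left diff_ge_0_iff_ge)
  ultimately show "emeasure lebesgue (cbox a (\<chi> i. a $ i + l)) = ennreal (l ^ CARD('n))"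
    and "emeasure lebesgue (box a (\<chi> i. a $ i + l)) = ennreal (l ^ CARD('n))"
    by (simp_all add: emeasure_lborel_cbox_eq emeasure_lborel_box_eq)
qed

lemma dyadic_cell_measurable [measurable]:
  fixes x :: "real ^ 'n"
  shows "dyadic_cell L n x \<in> sets lebesgue"
proof -
  have [measurable]: "(\<lambda>y :: real ^ 'n. y $ i) \<in> borel_measurable borel" for i
    by (intro borel_measurable_continuous_onI continuous_intros)
  have "dyadic_cell L n x = {y \<in> space borel. \<forall>i. \<lfloor>2 ^ n * y $ i / L\<rfloor> = \<lfloor>2 ^ n * x $ i / L\<rfloor>}"
    by (simp add: dyadic_cell_def)
  also have "\<dots> \<in> sets borel"
    by measurable
  finally show ?thesis by simp
qed

text \<open>The seminorm tests closed cubes only, while cells are half-open. A cell lies between the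
  open and the closed box with the same corners, which have equal measure, so enlarging it to a cube
  costs nothing.\<close>

lemma dyadic_cell_cube:
  fixes x :: "real ^ 'n"
  assumes "L > 0"
  obtains C where "is_cube C" "dyadic_cell L n x \<subseteq> C"
    "emeasure lebesgue C = ennreal ((L / 2 ^ n) ^ CARD('n))"
    "emeasure lebesgue (dyadic_cell L n x) = ennreal ((L / 2 ^ n) ^ CARD('n))"
proof -
  obtain a where a: "dyadic_cell L n x = {y. \<forall>i. a $ i \<le> y $ i \<and> y $ i < a $ i + L / 2 ^ n}"
    using dyadic_cell_bounds[OF assms] by blast
  let ?b = "\<chi> i. a $ i + L / 2 ^ n"
  have l: "0 \<le> L / 2 ^ n" using assms by simp
  have sub: "dyadic_cell L n x \<subseteq> cbox a ?b" "box a ?b \<subseteq> dyadic_cell L n x"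
    by (auto simp: a mem_box_cart less_imp_le)
  have "emeasure lebesgue (dyadic_cell L n x) = ennreal ((L / 2 ^ n) ^ CARD('n))"
  proof (rule antisym)
    show "emeasure lebesgue (dyadic_cell L n x) \<le> ennreal ((L / 2 ^ n) ^ CARD('n))"
      using emeasure_mono[OF sub(1), of lebesgue] emeasure_equilateral_box(1)[OF l, of a] by simp
    show "ennreal ((L / 2 ^ n) ^ CARD('n)) \<le> emeasure lebesgue (dyadic_cell L n x)"
      using emeasure_mono[OF sub(2), of lebesgue] emeasure_equilateral_box(2)[OF l, of a] by simp
  qed
  moreover have "is_cube (cbox a ?b)"
    unfolding is_cube_def using l
    by (intro exI[of _ a] exI[of _ "L / 2 ^ n"]) (auto simp: mem_box_cart)
  ultimately show thesis
    using that[OF _ sub(1)] emeasure_equilateral_box(1)[OF l, of a] by simp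
qed

lemma emeasure_dyadic_cell:
  fixes x :: "real ^ 'n"
  assumes "L > 0"
  shows "emeasure lebesgue (dyadic_cell L n x) = ennreal ((L / 2 ^ n) ^ CARD('n))"
  using dyadic_cell_cube[OF assms] by metis

text \<open>A cell is determined by its generation and an integer index vector.\<close>

lemma countable_dyadic_cells:
  "countable {dyadic_cell L n x | n x :: real ^ 'n. True}"
proof -
  let ?g = "\<lambda>(n, k :: 'n \<Rightarrow> int). {y :: real ^ 'n. \<forall>i. \<lfloor>2 ^ n * y $ i / L\<rfloor> = k i}"
  have "{dyadic_cell L n x | n x :: real ^ 'n. True} \<subseteq> range ?g"
  proof clarify
    fix n and x :: "real ^ 'n"
    show "dyadic_cell L n x \<in> range ?g"
      by (rule range_eqI[of _ _ "(n, \<lambda>i. \<lfloor>2 ^ n * x $ i / L\<rfloor>)"]) (simp add: dyadic_cell_def)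
  qed
  then show ?thesis
    by (rule countable_subset) simp
qed

lemma dyadic_cell_within_open:
  fixes x :: "real ^ 'n"
  assumes "L > 0" "open U" "x \<in> U"
  shows "\<exists>n. dyadic_cell L n x \<subseteq> U"
proof -
  obtain e where e: "e > 0" "ball x e \<subseteq> U"
    using assms openE by blast
  \<comment> \<open>The Euclidean norm is at most the sum of the \<open>CARD('n)\<close> coordinate
    differences, each at most the side \<open>L / 2 ^ n\<close>; this \<open>n\<close> makes the sum
    less than \<open>e\<close>.\<close>
  obtain n where n: "real CARD('n) * L / e < 2 ^ n"
    using real_arch_pow[of 2] by auto
  have "dyadic_cell L n x \<subseteq> ball x e"
  proof
    fix y assume y: "y \<in> dyadic_cell L n x"
    obtain a where a: "dyadic_cell L n x = {y. \<forall>i. a $ i \<le> y $ i \<and> y $ i < a $ i + L / 2 ^ n}"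
      using dyadic_cell_bounds[OF assms(1)] by blast
    have "\<bar>(x - y) $ i\<bar> \<le> L / 2 ^ n" for i
    proof -
      have "a $ i \<le> y $ i \<and> y $ i < a $ i + L / 2 ^ n" "a $ i \<le> x $ i \<and> x $ i < a $ i + L / 2 ^ n"
        using y mem_dyadic_cell_self[of x L n] unfolding a by blast+
      then show ?thesis unfolding vector_minus_component by linarith
    qed
    then have "(\<Sum>i\<in>UNIV. \<bar>(x - y) $ i\<bar>) \<le> real CARD('n) * (L / 2 ^ n)"
      by (intro sum_bounded_above)
    also have "\<dots> < e"
      using n e(1) by (simp add: field_simps)
    finally show "y \<in> ball x e"
      using norm_le_l1_cart[of "x - y"] by (simp add: dist_norm)
  qed
  with e show ?thesis by blast
qed

section \<open>Calderon-Zygmund selection of maximal cells\<close>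

text \<open>Along the chain of cells through \<open>x\<close>, from coarse to fine, the first one
  with \<open>P\<close> is kept. Generation 0 is the coarsest, so a first one exists as soon as any
  cell through \<open>x\<close> has \<open>P\<close>.\<close>

definition maximal_cells :: "real \<Rightarrow> ((real ^ 'n) set \<Rightarrow> bool) \<Rightarrow> (real ^ 'n) set set" where
  "maximal_cells L P =
    {dyadic_cell L n x | n x. P (dyadic_cell L n x) \<and> (\<forall>m<n. \<not> P (dyadic_cell L m x))}"

lemma countable_maximal_cells: "countable (maximal_cells L P)"
  by (rule countable_subset[OF _ countable_dyadic_cells[of L]]) (auto simp: maximal_cells_def)

lemma maximal_cells_measurable: "C \<in> maximal_cells L P \<Longrightarrow> C \<in> sets lebesgue"
  by (auto simp: maximal_cells_def)

lemma Union_maximal_cells: "\<Union>(maximal_cells L P) = {x. \<exists>n. P (dyadic_cell L n x)}"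
proof (intro equalityI subsetI)
  fix x assume "x \<in> \<Union>(maximal_cells L P)"
  then obtain n y where "x \<in> dyadic_cell L n y" "P (dyadic_cell L n y)"
    by (auto simp: maximal_cells_def)
  then show "x \<in> {x. \<exists>n. P (dyadic_cell L n x)}"
    using dyadic_cell_eq by (metis mem_Collect_eq)
next
  fix x assume "x \<in> {x. \<exists>n. P (dyadic_cell L n x)}"
  then obtain n where "P (dyadic_cell L n x)" "\<forall>m<n. \<not> P (dyadic_cell L m x)"
    using exists_least_iff[of "\<lambda>n. P (dyadic_cell L n x)"] by auto
  then show "x \<in> \<Union>(maximal_cells L P)"
    using mem_dyadic_cell_self unfolding maximal_cells_def by blast
qed

text \<open>Two cells with a common point are nested. If their generations differed, the coarser one
  would have \<open>P\<close> and contain the finer one, against the maximality of the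
  latter.\<close>

lemma disjoint_maximal_cells: "disjoint (maximal_cells L P)"
proof (rule disjointI)
  have mono: "\<not> m < n"
    if "z \<in> dyadic_cell L n x" "z \<in> dyadic_cell L m y"
      "P (dyadic_cell L m y)" "\<forall>k<n. \<not> P (dyadic_cell L k x)" for m n x y z
    using that dyadic_cell_antimono[of m n L x] dyadic_cell_eq[of z L m]
    by (metis less_imp_le subsetD)
  fix A B assume "A \<in> maximal_cells L P" "B \<in> maximal_cells L P" "A \<noteq> B"
  then obtain n x m y where A: "A = dyadic_cell L n x" "P A" "\<forall>k<n. \<not> P (dyadic_cell L k x)"
    and B: "B = dyadic_cell L m y" "P B" "\<forall>k<m. \<not> P (dyadic_cell L k y)"
    by (auto simp: maximal_cells_def)
  show "A \<inter> B = {}"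
  proof (rule ccontr)
    assume "A \<inter> B \<noteq> {}"
    then obtain z where z: "z \<in> A" "z \<in> B" by blast
    then have "n = m"
      using mono[of z n x m y] mono[of z m y n x] A B by fastforce
    then show False
      using z A(1) B(1) dyadic_cell_eq \<open>A \<noteq> B\<close> by metis
  qed
qed

section \<open>Passing from estimates on cells to global estimates\<close>

text \<open>Countable additivity on both sides. The union appears only on the left, since the part
  of \<open>B\<close> outside the pieces can only enlarge the right side.\<close>

lemma emeasure_le_by_pieces:
  assumes "countable F" "disjoint F" "\<And>C. C \<in> F \<Longrightarrow> C \<in> sets M"
    and "A \<in> sets M" "B \<in> sets M"
    and le: "\<And>C. C \<in> F \<Longrightarrow> emeasure M (A \<inter> C) \<le> c * emeasure M (B \<inter> C)"
  shows "emeasure M (A \<inter> \<Union>F) \<le> c * emeasure M B"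
proof -
  have disj: "disjoint_family_on (\<lambda>C. X \<inter> C) F" for X
    using assms(2) by (auto simp: disjoint_family_on_def disjoint_def)
  have sum: "emeasure M (X \<inter> \<Union>F) = (\<integral>\<^sup>+C. emeasure M (X \<inter> C) \<partial>count_space F)"
    if "X \<in> sets M" for X
  proof -
    have "X \<inter> \<Union>F = (\<Union>C\<in>F. X \<inter> C)" by blast
    then show ?thesis
      using emeasure_UN_countable[of F "\<lambda>C. X \<inter> C" M] assms(1,3) that disj by auto
  qed
  have "emeasure M (A \<inter> \<Union>F) = (\<integral>\<^sup>+C. emeasure M (A \<inter> C) \<partial>count_space F)"
    by (rule sum) fact
  also have "\<dots> \<le> (\<integral>\<^sup>+C. c * emeasure M (B \<inter> C) \<partial>count_space F)"
    by (rule nn_integral_mono) (simp add: le)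
  also have "\<dots> = c * emeasure M (B \<inter> \<Union>F)"
    by (simp add: nn_integral_cmult sum assms(5))
  also have "\<dots> \<le> c * emeasure M B"
    by (intro mult_left_mono emeasure_mono) (use assms in auto)
  finally show ?thesis .
qed

text \<open>
  This replaces the Lebesgue density theorem: an open superset \<open>U\<close> of \<open>B\<close> splits into disjoint
  dyadic cells, each at most half filled by \<open>B\<close>, so \<open>|U| \<ge> 2 |B|\<close>, against outer regularity.
\<close>

lemma sparse_in_dyadic_cells_null:
  fixes E :: "(real ^ 'n) set"
  assumes "L > 0" and E: "E \<in> sets lebesgue" and B: "B \<in> sets lebesgue" "B \<subseteq> E"
    and fin: "emeasure lebesgue B < \<infinity>"
    and sparse: "\<And>x n. x \<in> B \<Longrightarrow>
      2 * emeasure lebesgue (dyadic_cell L n x \<inter> E) \<le> emeasure lebesgue (dyadic_cell L n x)"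
  shows "emeasure lebesgue B = 0"
proof (rule ccontr)
  assume pos: "emeasure lebesgue B \<noteq> 0"
  have mB: "emeasure lebesgue B = ennreal (measure lebesgue B)"
    using fin by (intro emeasure_eq_ennreal_measure) simp
  with pos have mB_pos: "measure lebesgue B > 0"
    by (metis ennreal_0 measure_nonneg order_le_less)
  \<comment> \<open>The tolerance is the measure of \<open>B\<close> itself, which makes
    \<open>U\<close> have less than twice the measure of \<open>B\<close>.\<close>
  obtain U where U: "open U" "B \<subseteq> U" "U - B \<in> lmeasurable"
      "emeasure lebesgue (U - B) < ennreal (measure lebesgue B)"
    using sets_lebesgue_outer_open[OF B(1) mB_pos] by blast
  have mU: "U \<in> sets lebesgue" using U(1) by simp
  let ?F = "maximal_cells L (\<lambda>C. C \<subseteq> U)"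
  have "U \<subseteq> \<Union>?F"
    using dyadic_cell_within_open[OF assms(1) U(1)] unfolding Union_maximal_cells by blast
  then have BF: "B \<inter> \<Union>?F = B"
    using U(2) by blast
  have "emeasure lebesgue (B \<inter> \<Union>?F) \<le> ennreal (1/2) * emeasure lebesgue U"
  proof (rule emeasure_le_by_pieces)
    fix C assume C: "C \<in> ?F"
    show "emeasure lebesgue (B \<inter> C) \<le> ennreal (1/2) * emeasure lebesgue (U \<inter> C)"
    \<comment> \<open>Sparsity is assumed only for cells through points of \<open>B\<close>; a cell
      that misses \<open>B\<close> contributes nothing on the left.\<close>
    proof (cases "B \<inter> C = {}")
      case False
      then obtain x where x: "x \<in> B" "x \<in> C" by blast
      with C obtain n where n: "C = dyadic_cell L n x" "C \<subseteq> U"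
        by (auto simp: maximal_cells_def dest: dyadic_cell_eq)
      have "2 * emeasure lebesgue (B \<inter> C) \<le> 2 * emeasure lebesgue (C \<inter> E)"
        by (intro mult_left_mono emeasure_mono) (use B E n in auto)
      also have "\<dots> \<le> emeasure lebesgue (U \<inter> C)"
        using sparse[OF x(1), of n] n by (simp add: Int_absorb1)
      finally have "ennreal (1/2) * (2 * emeasure lebesgue (B \<inter> C)) \<le> ennreal (1/2) * emeasure lebesgue (U \<inter> C)"
        by (rule mult_left_mono) simp
      moreover have "ennreal (1/2) * (2 * a) = a" for a
      proof -
        have "ennreal (1/2) * 2 = ennreal (1/2 * 2)"
          by (subst ennreal_mult) auto
        then show ?thesis by (simp only: mult.assoc[symmetric]) simp
      qed
      ultimately show ?thesis by simp
    qed simp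
  qed (use B mU countable_maximal_cells disjoint_maximal_cells maximal_cells_measurable in auto)
  also have "emeasure lebesgue U = emeasure lebesgue B + emeasure lebesgue (U - B)"
    using plus_emeasure[of B lebesgue "U - B"] B U mU by (simp add: Un_absorb1)
  also have "emeasure lebesgue (U - B) = ennreal (measure lebesgue (U - B))"
    using U(3) by (simp add: emeasure_eq_measure2)
  finally have "measure lebesgue B \<le> 1/2 * (measure lebesgue B + measure lebesgue (U - B))"
    unfolding BF mB
    by (subst (asm) ennreal_plus[symmetric], simp, simp)
      (subst (asm) ennreal_mult[symmetric]; simp add: ennreal_le_iff del: ennreal_plus)
  moreover have "measure lebesgue (U - B) < measure lebesgue B"
    using U(3,4) by (simp add: emeasure_eq_measure2 ennreal_less_iff)
  ultimately show False by simp
qed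

section \<open>Mean oscillation and the size of superlevel sets\<close>

text \<open>A Chebyshev-type bound: the double integral over \<open>C\<close> dominates its part
  with \<open>x\<close> in \<open>A\<close> and \<open>z\<close> in \<open>B\<close>, where the
  integrand is at least \<open>t\<close>.\<close>

lemma oscillation_le_bmo_norm:
  assumes C: "is_cube C" "emeasure lebesgue C = ennreal c" "c > 0"
    and AB: "A \<subseteq> C" "B \<subseteq> C" "A \<in> sets lebesgue" "B \<in> sets lebesgue"
    and gap: "\<And>x z. x \<in> A \<Longrightarrow> z \<in> B \<Longrightarrow> t \<le> \<bar>u z - u x\<bar>"
  shows "ennreal t * emeasure lebesgue B * emeasure lebesgue A \<le> bmo_norm u * ennreal (c\<^sup>2)"
proof -
  let ?I = "\<integral>\<^sup>+x\<in>C. (\<integral>\<^sup>+z\<in>C. ennreal \<bar>u z - u x\<bar> \<partial>lebesgue) \<partial>lebesgue"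
  have "ennreal t * emeasure lebesgue B * emeasure lebesgue A
      = (\<integral>\<^sup>+x. (\<integral>\<^sup>+z. ennreal t * indicator B z \<partial>lebesgue) * indicator A x \<partial>lebesgue)"
    using AB by (simp add: nn_integral_cmult)
  also have "\<dots> \<le> ?I"
  proof (rule nn_integral_mono)
    fix x
    show "(\<integral>\<^sup>+z. ennreal t * indicator B z \<partial>lebesgue) * indicator A x
        \<le> (\<integral>\<^sup>+z\<in>C. ennreal \<bar>u z - u x\<bar> \<partial>lebesgue) * indicator C x"
    proof (cases "x \<in> A")
      case True
      have "(\<integral>\<^sup>+z. ennreal t * indicator B z \<partial>lebesgue) \<le> (\<integral>\<^sup>+z\<in>C. ennreal \<bar>u z - u x\<bar> \<partial>lebesgue)"
        using gap[OF True] AB(2)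
        by (intro nn_integral_mono) (auto simp: indicator_def intro!: ennreal_leI)
      with True AB(1) show ?thesis by (auto simp: indicator_def)
    qed simp
  qed
  \<comment> \<open>As \<open>c\<close> is positive and finite, dividing and multiplying by its
    square is harmless, and \<open>C\<close> is among the cubes of the supremum.\<close>
  also have "?I = ?I / (emeasure lebesgue C)\<^sup>2 * ennreal (c\<^sup>2)"
    using C(2,3) by (simp add: ennreal_power ennreal_divide_times mult_divide_eq_ennreal)
  also have "\<dots> \<le> bmo_norm u * ennreal (c\<^sup>2)"
    unfolding bmo_norm_def using C by (intro mult_right_mono SUP_upper) auto
  finally show ?thesis .
qed

text \<open>Truncations to growing balls are integrable, and at each point they are eventually equal
  to \<open>u\<close>.\<close>

lemma locally_L1_measurable:
  assumes "locally_L1 u"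
  shows "u \<in> borel_measurable lebesgue"
proof (rule borel_measurable_LIMSEQ_real)
  fix n :: nat
  show "(\<lambda>x. indicator (cball 0 (real n)) x *\<^sub>R u x) \<in> borel_measurable lebesgue"
    using assms unfolding locally_L1_def set_integrable_def
    by (intro borel_measurable_integrable) auto
next
  fix x
  show "(\<lambda>n. indicator (cball 0 (real n)) x *\<^sub>R u x) \<longlonglongrightarrow> u x"
  proof (rule tendsto_eventually)
    obtain k where "norm x \<le> real k" using real_arch_simple by blast
    then have "indicator (cball 0 (real n)) x *\<^sub>R u x = u x" if "n \<ge> k" for n
      using that by (simp add: indicator_def)
    then show "\<forall>\<^sub>F n in sequentially. indicator (cball 0 (real n)) x *\<^sub>R u x = u x"
      unfolding eventually_sequentially by blast
  qed
qed

lemma superlevel_measurable: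
  assumes "u \<in> borel_measurable lebesgue"
  shows "superlevel u s \<in> sets lebesgue"
proof -
  have "{x \<in> space lebesgue. s < \<bar>u x\<bar>} \<in> sets lebesgue"
    using assms by measurable
  then show ?thesis by (simp add: superlevel_def)
qed

lemma superlevel_antimono: "s \<le> t \<Longrightarrow> superlevel u t \<subseteq> superlevel u s"
  by (auto simp: superlevel_def)

text \<open>The exponent collects three losses: \<open>2 ^ CARD('n)\<close> from comparing the
  parent with its child, one factor 2 because at least half of the sparse parent lies outside
  \<open>superlevel u s\<close>, and one because more than half of the dense child lies
  inside.\<close>

lemma emeasure_superlevel_in_dense_cell:
  fixes u :: "real ^ 'n \<Rightarrow> real"
  assumes u: "u \<in> borel_measurable lebesgue" and M: "bmo_norm u \<le> ennreal M" "M \<ge> 0"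
    and "t > 0" "L > 0"
    and dense: "emeasure lebesgue (dyadic_cell L (Suc k) x)
      < 2 * emeasure lebesgue (dyadic_cell L (Suc k) x \<inter> superlevel u s)"
    and sparse: "2 * emeasure lebesgue (dyadic_cell L k x \<inter> superlevel u s)
      \<le> emeasure lebesgue (dyadic_cell L k x)"
  shows "emeasure lebesgue (superlevel u (s + t) \<inter> dyadic_cell L (Suc k) x)
    \<le> ennreal (2 ^ (CARD('n) + 2) * M / t)
        * emeasure lebesgue (superlevel u s \<inter> dyadic_cell L (Suc k) x)"
proof -
  let ?E = "superlevel u s" and ?G = "superlevel u (s + t)"
  let ?P = "dyadic_cell L k x" and ?Q = "dyadic_cell L (Suc k) x"
  define p where "p = (L / 2 ^ k) ^ CARD('n)"
  define q where "q = (L / 2 ^ Suc k) ^ CARD('n)"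
  have pq: "p > 0" "q > 0" "p = 2 ^ CARD('n) * q"
    using \<open>L > 0\<close> by (simp_all add: p_def q_def field_simps power_mult_distrib power_divide)
  have meas [measurable]: "superlevel u r \<in> sets lebesgue" for r
    by (rule superlevel_measurable[OF u])
  obtain C where C: "is_cube C" "?P \<subseteq> C" "emeasure lebesgue C = ennreal p"
    and P: "emeasure lebesgue ?P = ennreal p"
    using dyadic_cell_cube[OF \<open>L > 0\<close>, of k x] unfolding p_def by blast
  have Q: "emeasure lebesgue ?Q = ennreal q"
    unfolding q_def by (rule emeasure_dyadic_cell[OF \<open>L > 0\<close>])
  have lm: "?P \<in> lmeasurable" "?Q \<in> lmeasurable"
    using P Q by (auto intro!: fmeasurableI)
  have mP: "measure lebesgue ?P = p"
    using P pq by (simp add: measure_def)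
  \<comment> \<open>All sets involved lie in cells of finite measure, so the argument can move to
    real numbers, where subtraction and cancellation are available.\<close>
  have em: "emeasure lebesgue (?P \<inter> X) = ennreal (measure lebesgue (?P \<inter> X))"
      "emeasure lebesgue (?Q \<inter> X) = ennreal (measure lebesgue (?Q \<inter> X))"
      "emeasure lebesgue (?P - X) = ennreal (measure lebesgue (?P - X))"
    if "X \<in> sets lebesgue" for X
    using lm that
    by (intro emeasure_eq_measure2 fmeasurable_Int_fmeasurable fmeasurable_Diff; simp)+
  have "q < 2 * measure lebesgue (?Q \<inter> ?E)"
    using dense pq(2) unfolding Q em(2)[OF meas]
    by (simp add: ennreal_less_iff flip: ennreal_mult ennreal_numeral)
  moreover have "2 * measure lebesgue (?P \<inter> ?E) \<le> p"
    using sparse pq(1) unfolding P em(1)[OF meas]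
    by (simp flip: ennreal_mult ennreal_numeral)
  moreover have "measure lebesgue (?P - ?E) = p - measure lebesgue (?P \<inter> ?E)"
    using measurable_measure_Diff[of ?P lebesgue "?P \<inter> ?E"] lm mP by (simp add: Diff_Int)
  moreover have osc: "t * measure lebesgue (?P - ?E) * measure lebesgue (?P \<inter> ?G) \<le> M * p\<^sup>2"
  proof -
    have "ennreal t * emeasure lebesgue (?P - ?E) * emeasure lebesgue (?P \<inter> ?G)
        \<le> bmo_norm u * ennreal (p\<^sup>2)"
      \<comment> \<open>Off \<open>?E\<close> the values of \<open>\<bar>u\<bar>\<close> are at most
        \<open>s\<close>, on \<open>?G\<close> they exceed \<open>s + t\<close>; the reverse
        triangle inequality gives the gap \<open>t\<close>.\<close>
      by (rule oscillation_le_bmo_norm[OF C(1,3) pq(1)]) (use C(2) in auto, auto simp: superlevel_def)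
    also have "\<dots> \<le> ennreal M * ennreal (p\<^sup>2)"
      by (intro mult_right_mono M) simp
    finally show ?thesis
      using \<open>t > 0\<close> M(2) unfolding em(1)[OF meas] em(3)[OF meas]
      by (simp flip: ennreal_mult)
  qed
  moreover have "measure lebesgue (?Q \<inter> ?G) \<le> measure lebesgue (?P \<inter> ?G)"
    using lm dyadic_cell_antimono[of k "Suc k" L x]
    by (intro measure_mono_fmeasurable fmeasurable_Int_fmeasurable) auto
  ultimately have
    E: "q < 2 * measure lebesgue (?Q \<inter> ?E)" "p \<le> 2 * measure lebesgue (?P - ?E)"
    and G: "measure lebesgue (?Q \<inter> ?G) \<le> measure lebesgue (?P \<inter> ?G)"
    by auto
  have "(t * measure lebesgue (?P \<inter> ?G)) * p \<le> (t * measure lebesgue (?P \<inter> ?G)) * (2 * measure lebesgue (?P - ?E))"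
    using E(2) \<open>t > 0\<close> by (intro mult_left_mono) auto
  also have "\<dots> \<le> (2 * M * p) * p"
    using osc by (simp add: power2_eq_square mult_ac)
  finally have "t * measure lebesgue (?P \<inter> ?G) \<le> 2 * M * p"
    using pq(1) by simp
  also have "\<dots> = 2 * M * 2 ^ CARD('n) * q"
    using pq(3) by simp
  also have "\<dots> \<le> 2 * M * 2 ^ CARD('n) * (2 * measure lebesgue (?Q \<inter> ?E))"
    using E(1) M(2) by (intro mult_left_mono) auto
  finally have "t * measure lebesgue (?P \<inter> ?G) \<le> 2 ^ (CARD('n) + 2) * M * measure lebesgue (?Q \<inter> ?E)"
    by (simp add: mult_ac)
  then have "measure lebesgue (?P \<inter> ?G) \<le> 2 ^ (CARD('n) + 2) * M / t * measure lebesgue (?Q \<inter> ?E)"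
    using \<open>t > 0\<close> by (simp add: pos_le_divide_eq mult_ac)
  with G have "measure lebesgue (?Q \<inter> ?G) \<le> 2 ^ (CARD('n) + 2) * M / t * measure lebesgue (?Q \<inter> ?E)"
    by linarith
  then show ?thesis
    using M(2) \<open>t > 0\<close> unfolding Int_commute[of _ ?Q] em(2)[OF meas]
    by (subst ennreal_mult[symmetric]) (auto intro: ennreal_leI)
qed

section \<open>Decay of the measure of superlevel sets as the level rises\<close>

text \<open>Finite measure allows a coarsest generation without dense cells. Every maximal dense
  cell then has a sparse parent, and the estimates on single cells can be summed.\<close>

lemma emeasure_superlevel_add_le:
  fixes u :: "real ^ 'n \<Rightarrow> real"
  assumes u: "u \<in> borel_measurable lebesgue" and M: "bmo_norm u \<le> ennreal M" "M \<ge> 0"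
    and "t > 0" and fin: "emeasure lebesgue (superlevel u s) < \<infinity>"
  shows "emeasure lebesgue (superlevel u (s + t))
    \<le> ennreal (2 ^ (CARD('n) + 2) * M / t) * emeasure lebesgue (superlevel u s)"
proof -
  let ?E = "superlevel u s" and ?G = "superlevel u (s + t)"
  note meas [measurable] = superlevel_measurable[OF u]
  \<comment> \<open>A generation 0 cell has measure \<open>L ^ CARD('n)\<close>, which is at least
    \<open>L\<close> because \<open>L \<ge> 1\<close>, hence exceeds twice the measure of
    \<open>?E\<close>.\<close>
  define L where "L = 2 * measure lebesgue ?E + 1"
  have L: "L \<ge> 1" by (simp add: L_def)
  have mE: "emeasure lebesgue ?E = ennreal (measure lebesgue ?E)"
    using fin by (intro emeasure_eq_ennreal_measure) simp
  \<comment> \<open>The inequality is strict, so that the negation of \<open>D\<close> is exactly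
    the sparsity condition of the earlier lemmas.\<close>
  define D where "D C \<longleftrightarrow> emeasure lebesgue C < 2 * emeasure lebesgue (C \<inter> ?E)" for C
  let ?F = "maximal_cells L D"
  have top: "\<not> D (dyadic_cell L 0 x)" for x
  proof -
    have "2 * emeasure lebesgue (dyadic_cell L 0 x \<inter> ?E) \<le> 2 * emeasure lebesgue ?E"
      by (intro mult_left_mono emeasure_mono) auto
    also have "\<dots> = ennreal (2 * measure lebesgue ?E)"
      by (simp add: mE ennreal_mult)
    also have "\<dots> \<le> ennreal (L ^ CARD('n))"
      using self_le_power[OF L, of "CARD('n)"] by (intro ennreal_leI) (simp add: L_def)
    also have "\<dots> = emeasure lebesgue (dyadic_cell L 0 x)"
      using L by (subst emeasure_dyadic_cell) auto
    finally show ?thesis by (simp add: D_def)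
  qed
  have F: "\<Union>?F \<in> sets lebesgue"
    by (intro sets.countable_Union countable_maximal_cells) (auto dest: maximal_cells_measurable)
  have "emeasure lebesgue (?E - \<Union>?F) \<le> emeasure lebesgue ?E"
    by (intro emeasure_mono) auto
  \<comment> \<open>A point of \<open>?E\<close> in no maximal cell lies in sparse cells only, at
    every generation.\<close>
  then have null: "emeasure lebesgue (?E - \<Union>?F) = 0"
    using F L fin
    by (intro sparse_in_dyadic_cells_null[of L ?E])
      (auto simp: Union_maximal_cells D_def not_less)
  have "emeasure lebesgue ?G \<le> emeasure lebesgue ((?G \<inter> \<Union>?F) \<union> (?E - \<Union>?F))"
    using superlevel_antimono[of s "s + t" u] \<open>t > 0\<close> F by (intro emeasure_mono) auto
  also have "\<dots> \<le> emeasure lebesgue (?G \<inter> \<Union>?F)"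
    using emeasure_subadditive[of "?G \<inter> \<Union>?F" lebesgue "?E - \<Union>?F"] F null by auto
  also have "\<dots> \<le> ennreal (2 ^ (CARD('n) + 2) * M / t) * emeasure lebesgue ?E"
  proof (rule emeasure_le_by_pieces)
    fix C assume "C \<in> ?F"
    then obtain n x where C: "C = dyadic_cell L n x" "D C" "\<forall>m<n. \<not> D (dyadic_cell L m x)"
      by (auto simp: maximal_cells_def)
    \<comment> \<open>Generation 0 is excluded by \<open>top\<close>, so the parent exists; it is
      sparse by maximality.\<close>
    with top obtain k where "n = Suc k" by (cases n) auto
    with C L show "emeasure lebesgue (?G \<inter> C)
        \<le> ennreal (2 ^ (CARD('n) + 2) * M / t) * emeasure lebesgue (?E \<inter> C)"
      using emeasure_superlevel_in_dense_cell[OF u M \<open>t > 0\<close>, of L k x s]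
      by (auto simp: D_def not_less)
  qed (use countable_maximal_cells disjoint_maximal_cells maximal_cells_measurable in auto)
  finally show ?thesis .
qed

text \<open>The increment is the value of \<open>t\<close> for which the factor
  \<open>2 ^ (CARD('n) + 2) * M / t\<close> of a single step equals \<open>1 / 2\<close>.\<close>

lemma emeasure_superlevel_halving:
  fixes u :: "real ^ 'n \<Rightarrow> real"
  assumes u: "u \<in> borel_measurable lebesgue" and M: "bmo_norm u \<le> ennreal M" "M > 0"
    and fin: "emeasure lebesgue (superlevel u s) < \<infinity>"
  shows "emeasure lebesgue (superlevel u (s + real k * (2 ^ (CARD('n) + 3) * M)))
    \<le> ennreal ((1 / 2) ^ k) * emeasure lebesgue (superlevel u s)"
proof (induction k)
  case (Suc k)
  let ?t = "2 ^ (CARD('n) + 3) * M"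
  let ?S = "\<lambda>k. superlevel u (s + real k * ?t)"
  \<comment> \<open>Finiteness is inherited by the higher level, which permits the next
    step.\<close>
  have "emeasure lebesgue (?S k) < \<infinity>"
    using le_less_trans[OF Suc.IH] fin by (simp add: ennreal_mult_less_top)
  then have "emeasure lebesgue (superlevel u (s + real k * ?t + ?t))
      \<le> ennreal (2 ^ (CARD('n) + 2) * M / ?t) * emeasure lebesgue (?S k)"
    using M by (intro emeasure_superlevel_add_le[OF u]) auto
  also have "s + real k * ?t + ?t = s + real (Suc k) * ?t"
    by (simp add: algebra_simps)
  also have "2 ^ (CARD('n) + 2) * M / ?t = 1 / 2"
    using M(2) by (simp add: power_add)
  also have "ennreal (1 / 2) * emeasure lebesgue (?S k)
      \<le> ennreal (1 / 2) * (ennreal ((1 / 2) ^ k) * emeasure lebesgue (superlevel u s))"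
    by (intro mult_left_mono Suc.IH) simp
  also have "\<dots> = ennreal ((1 / 2) ^ Suc k) * emeasure lebesgue (superlevel u s)"
    by (simp only: power_Suc mult.assoc[symmetric]) (subst ennreal_mult; simp)
  finally show ?case .
qed simp

theorem theorem1p3:
  "\<exists>\<gamma>>0. \<exists>\<alpha>>0. \<forall>u :: real ^ 'n \<Rightarrow> real. u \<in> BMO \<longrightarrow>
    (\<forall>\<eta> \<sigma>. 0 \<le> \<eta> \<and> \<eta> \<le> \<sigma> \<longrightarrow>
      emeasure lebesgue (superlevel u \<sigma>)
        \<le> ennreal (\<gamma> * exp (- \<alpha> * ((\<sigma> - \<eta>) / enn2real (bmo_norm u))))
            * emeasure lebesgue (superlevel u \<eta>))"
proof -
  \<comment> \<open>The measure halves whenever the level rises by \<open>?K\<close> times the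
    seminorm, hence the rate \<open>ln 2 / ?K\<close>.\<close>
  let ?K = "2 ^ (CARD('n) + 3) :: real"
  have "emeasure lebesgue (superlevel u \<sigma>)
        \<le> ennreal (2 * exp (- (ln 2 / ?K) * ((\<sigma> - \<eta>) / enn2real (bmo_norm u))))
            * emeasure lebesgue (superlevel u \<eta>)"
    if uB: "u \<in> BMO" and le: "\<eta> \<le> \<sigma>" for u :: "real ^ 'n \<Rightarrow> real" and \<eta> \<sigma>
  proof -
    define M where "M = enn2real (bmo_norm u)"
    have u: "u \<in> borel_measurable lebesgue" and M: "bmo_norm u = ennreal M" "M \<ge> 0"
      using uB locally_L1_measurable by (auto simp: BMO_def M_def)
    note meas = superlevel_measurable[OF u]
    consider "emeasure lebesgue (superlevel u \<eta>) = \<infinity>" | "M = 0"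
      | "emeasure lebesgue (superlevel u \<eta>) < \<infinity>" "M > 0"
      using M(2) by (metis ennreal_cases infinity_ennreal_def less_top order_le_less)
    then have "emeasure lebesgue (superlevel u \<sigma>)
        \<le> ennreal (2 * exp (- (ln 2 / ?K) * ((\<sigma> - \<eta>) / M))) * emeasure lebesgue (superlevel u \<eta>)"
    proof cases
      \<comment> \<open>The right side is infinite, its coefficient being positive.\<close>
      case 1
      then show ?thesis by (simp add: ennreal_mult_top)
    next
      \<comment> \<open>Division by zero yields 0, so the exponential is 1 and monotonicity in the
        level suffices.\<close>
      case 2
      have "emeasure lebesgue (superlevel u \<sigma>) \<le> 1 * emeasure lebesgue (superlevel u \<eta>)"
        using emeasure_mono[OF superlevel_antimono[OF le] meas] by simp
      also have "\<dots> \<le> 2 * emeasure lebesgue (superlevel u \<eta>)"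
        by (intro mult_right_mono) auto
      finally show ?thesis using 2 by simp
    next
      case 3
      \<comment> \<open>\<open>r\<close> counts the halvings that fit between the two levels; only
        its integer part \<open>k\<close> can be carried out.\<close>
      define r where "r = (\<sigma> - \<eta>) / (?K * M)"
      define k where "k = nat \<lfloor>r\<rfloor>"
      have "r \<ge> 0" using le 3(2) by (simp add: r_def)
      then have k: "real k \<le> r" "r \<le> real k + 1"
        unfolding k_def by linarith+
      have "\<eta> + real k * (?K * M) \<le> \<sigma>"
        using k(1) 3(2) by (simp add: r_def pos_le_divide_eq)
      then have "emeasure lebesgue (superlevel u \<sigma>)
          \<le> emeasure lebesgue (superlevel u (\<eta> + real k * (?K * M)))"
        by (intro emeasure_mono superlevel_antimono meas)
      also have "\<dots> \<le> ennreal ((1 / 2) ^ k) * emeasure lebesgue (superlevel u \<eta>)"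
        using emeasure_superlevel_halving[OF u _ 3(2,1)] M by simp
      also have "\<dots> \<le> ennreal (2 * exp (- (ln 2 / ?K) * ((\<sigma> - \<eta>) / M)))
          * emeasure lebesgue (superlevel u \<eta>)"
      proof (intro mult_right_mono ennreal_leI)
        have "(1 / 2 :: real) ^ k = exp (- (ln 2 * real k))"
          by (simp add: exp_minus exp_of_nat2_mult power_one_over inverse_eq_divide)
        \<comment> \<open>The lost fraction of a halving is paid for by the summand
          \<open>ln 2\<close>, which becomes the constant 2.\<close>
        also have "\<dots> \<le> exp (ln 2 + - (ln 2 * r))"
          using mult_left_mono[OF k(2), of "ln 2"] by (simp add: algebra_simps)
        also have "\<dots> = 2 * exp (- (ln 2 / ?K) * ((\<sigma> - \<eta>) / M))"
          by (simp add: exp_add r_def del: add_uminus_conv_diff)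
        finally show "(1 / 2) ^ k \<le> 2 * exp (- (ln 2 / ?K) * ((\<sigma> - \<eta>) / M))" .
      qed simp
      finally show ?thesis .
    qed
    then show ?thesis by (simp add: M_def)
  qed
  moreover have "ln 2 / ?K > 0" by simp
  ultimately show ?thesis
    by (intro exI[of _ "2::real"] exI[of _ "ln 2 / ?K"] conjI) auto
qed

end
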